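(* Let $P$ be a point inside a triangle $ABC$ such that $\angle ABP=10^\circ$, $\angle PBC=30^\circ$, $\angle BCP=80^\circ$, and $\angle PCA=20^\circ$. Let the cevians through $P$ be $AD$, $BE$, $CF$ with $D$ on $BC$, $E$ on $CA$, $F$ on $AB$, and let $r_1,\dots,r_6$ be the inradii of triangles $PBD$, $PDC$, $PCE$, $PEA$, $PAF$, $PFB$, respectively. Then $$5r_1+6r_2+r_4=r_3+3r_5+15r_6.$$
   Context: For a point $P$ inside $\triangle ABC$, line $AP$ meets side $BC$ at $D$, line $BP$ meets side $CA$ at $E$, and line $CP$ meets side $AB$ at $F$. The three cevians divide $\triangle ABC$ into six smaller triangles, numbered 1 to 6 in the order $PBD$, $PDC$, $PCE$, $PEA$, $PAF$, $PFB$; $r_i$ is the inradius of the $i$-th triangle. *)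

theory Defs
  imports "HOL-Analysis.Analysis"
begin

text \<open>The unoriented angle at the vertex \<open>Y\<close>, in radians.  It is meaningful only for
  \<open>X \<noteq> Y\<close> and \<open>Z \<noteq> Y\<close>.\<close>

definition angle :: "'a::real_inner \<Rightarrow> 'a \<Rightarrow> 'a \<Rightarrow> real" where
  "angle X Y Z = arccos (((X - Y) \<bullet> (Z - Y)) / (norm (X - Y) * norm (Z - Y)))"

definition degrees :: "real \<Rightarrow> real" where
  "degrees x = x * pi / 180"

text \<open>A circle is inscribed in a triangle if its disc lies in the triangle and it touches all
  three sides; a circle bounding a disc inside the triangle that meets a side is
  tangent to that side.\<close>

definition incircle :: "real^2 \<Rightarrow> real^2 \<Rightarrow> real^2 \<Rightarrow> real^2 \<Rightarrow> real \<Rightarrow> bool" where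
  "incircle X Y Z I r \<longleftrightarrow>
     0 < r \<and> cball I r \<subseteq> convex hull {X, Y, Z} \<and>
     sphere I r \<inter> closed_segment X Y \<noteq> {} \<and>
     sphere I r \<inter> closed_segment Y Z \<noteq> {} \<and>
     sphere I r \<inter> closed_segment Z X \<noteq> {}"

text \<open>The description is proper for every non-degenerate triangle.\<close>

definition inradius :: "real^2 \<Rightarrow> real^2 \<Rightarrow> real^2 \<Rightarrow> real" where
  "inradius X Y Z = (THE r. \<exists>I. incircle X Y Z I r)"

end

theory Submission
  imports Defs
begin

text \<open>
  With \<open>PC\<close> as unit of length, solving the triangle \<open>PBC\<close> gives \<open>PB = 2 sin 80\<degree>\<close>, and then
  \<open>sin 60\<degree> + 2 sin 80\<degree> sin 10\<degree> = sin 60\<degree> + sin 20\<degree> = 2 sin 40\<degree> cos 20\<degree>\<close> gives \<open>CA = 2 cos 20\<degree>\<close>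
  and \<open>PA = 1\<close>.  All lines of the figure then have directions that are multiples of
  \<open>10\<degree>\<close> relative to \<open>BP\<close>, and each small triangle has a known side among \<open>PA\<close>, \<open>PB\<close>, \<open>PC\<close>
  with known adjacent angles \<open>\<alpha>\<close>, \<open>\<beta>\<close>; a side \<open>c\<close> yields the inradius
  \<open>c sin \<alpha> sin \<beta> / (sin \<alpha> + sin \<beta> + sin (\<alpha> + \<beta>))\<close>.  The relation is then an identity in the
  number field generated by \<open>2 cos 10\<degree>\<close>.
\<close>

section \<open>Signed areas and membership in a triangle\<close>

text \<open>This is the signed area of the parallelogram spanned by \<open>u\<close> and
  \<open>v\<close>. Hence \<open>cross2 (Y - X) (Q - X)\<close> is the length of \<open>XY\<close>
  times the signed distance of \<open>Q\<close> from that line.\<close>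

definition cross2 :: "real^2 \<Rightarrow> real^2 \<Rightarrow> real" where
  "cross2 u v = u $ 1 * v $ 2 - u $ 2 * v $ 1"

lemma cross2_simps [simp]:
  "cross2 u u = 0" "cross2 0 v = 0" "cross2 u 0 = 0"
  "cross2 (a *\<^sub>R u) v = a * cross2 u v" "cross2 u (a *\<^sub>R v) = a * cross2 u v"
  "cross2 (- u) v = - cross2 u v" "cross2 u (- v) = - cross2 u v"
  by (simp_all add: cross2_def algebra_simps)

lemma cross2_distrib:
  "cross2 (u + v) w = cross2 u w + cross2 v w" "cross2 w (u + v) = cross2 w u + cross2 w v"
  "cross2 (u - v) w = cross2 u w - cross2 v w" "cross2 w (u - v) = cross2 w u - cross2 w v"
  by (simp_all add: cross2_def algebra_simps)

text \<open>Lagrange's identity: sine squared plus cosine squared, scaled by the squared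
  lengths.\<close>

lemma cross2_sq_plus_inner_sq: "(cross2 u v)\<^sup>2 + (u \<bullet> v)\<^sup>2 = (norm u * norm v)\<^sup>2"
  by (simp add: power_mult_distrib power2_norm_eq_inner cross2_def inner_vec_def sum_2)
     (simp add: algebra_simps power2_eq_square)

text \<open>Serves to bound the change of a signed area over a side when the point moves, which
  yields both directions of the incircle criterion.\<close>

lemma abs_cross2_le: "\<bar>cross2 u v\<bar> \<le> norm u * norm v"
proof -
  have "(cross2 u v)\<^sup>2 \<le> (norm u * norm v)\<^sup>2"
    using cross2_sq_plus_inner_sq[of u v] by (smt (verit) zero_le_power2)
  then show ?thesis
    using abs_le_square_iff[of "cross2 u v" "norm u * norm v"] by (simp add: abs_mult)
qed

text \<open>Barycentric coordinates are ratios of signed areas; clearing the denominator makes this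
  a polynomial identity, valid for degenerate triangles too.\<close>

lemma cross2_barycentric:
  "cross2 (Y - X) (Z - X) *\<^sub>R Q =
     cross2 (Z - Y) (Q - Y) *\<^sub>R X + cross2 (X - Z) (Q - Z) *\<^sub>R Y + cross2 (Y - X) (Q - X) *\<^sub>R Z"
  by (simp add: vec_eq_iff forall_2 cross2_def algebra_simps)

lemma cross2_sum_edges:
  "cross2 (Z - Y) (Q - Y) + cross2 (X - Z) (Q - Z) + cross2 (Y - X) (Q - X) = cross2 (Y - X) (Z - X)"
  by (simp add: cross2_def algebra_simps)

lemma cross2_rotate: "cross2 (Z - Y) (X - Y) = cross2 (Y - X) (Z - X)"
  by (simp add: cross2_def algebra_simps)

text \<open>Eliminating \<open>u\<close> writes \<open>Q - X\<close> in the two edges at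
  \<open>X\<close>, and the edge \<open>Y - X\<close> contributes no area against itself.\<close>

lemma cross2_combination:
  assumes "u + v + w = 1" "Q = u *\<^sub>R X + v *\<^sub>R Y + w *\<^sub>R Z"
  shows "cross2 (Y - X) (Q - X) = w * cross2 (Y - X) (Z - X)"
proof -
  have u: "u = 1 - v - w" using assms(1) by simp
  have "Q - X = v *\<^sub>R (Y - X) + w *\<^sub>R (Z - X)"
    unfolding assms(2) u by (simp add: algebra_simps)
  then show ?thesis by (simp add: cross2_distrib(2))
qed

text \<open>By Lagrange's identity a vanishing area is the equality case of Cauchy-Schwarz.\<close>

lemma cross2_eq_0_imp_collinear:
  assumes "cross2 (Y - X) (Z - X) = 0"
  shows "collinear {X, Y, Z}"
proof -
  have "((Y - X) \<bullet> (Z - X))\<^sup>2 = (norm (Y - X) * norm (Z - X))\<^sup>2"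
    using cross2_sq_plus_inner_sq[of "Y - X" "Z - X"] assms by simp
  then have "\<bar>(Y - X) \<bullet> (Z - X)\<bar> = norm (Y - X) * norm (Z - X)"
    by (auto simp: power2_eq_iff abs_mult)
  then have "collinear {0, Y - X, Z - X}"
    by (simp add: norm_cauchy_schwarz_equal)
  then have "collinear {Y, X, Z}"
    by (simp add: collinear_3)
  then show ?thesis
    by (simp add: insert_commute)
qed

text \<open>The three areas divided by the area of the whole triangle are the barycentric
  coordinates of \<open>Q\<close>. Multiplying by \<open>s\<close> makes the denominator positive,
  so only the signs of the numerators matter.\<close>

lemma in_triangle_iff:
  assumes "0 < s * cross2 (Y - X) (Z - X)"
  shows "Q \<in> convex hull {X, Y, Z} \<longleftrightarrow>
    0 \<le> s * cross2 (Y - X) (Q - X) \<and> 0 \<le> s * cross2 (Z - Y) (Q - Y) \<and> 0 \<le> s * cross2 (X - Z) (Q - Z)"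
    (is "_ \<longleftrightarrow> ?z \<and> ?x \<and> ?y")
proof
  assume "Q \<in> convex hull {X, Y, Z}"
  then obtain u v w where uvw: "0 \<le> u" "0 \<le> v" "0 \<le> w" "u + v + w = 1"
    and Q: "Q = u *\<^sub>R X + v *\<^sub>R Y + w *\<^sub>R Z"
    unfolding convex_hull_3 by auto
  have "cross2 (Y - X) (Q - X) = w * cross2 (Y - X) (Z - X)"
    using uvw(4) Q by (rule cross2_combination)
  moreover have "cross2 (Z - Y) (Q - Y) = u * cross2 (Y - X) (Z - X)"
    using cross2_combination[of v w u Q Y Z X] uvw Q by (simp add: cross2_rotate add_ac)
  moreover have "cross2 (X - Z) (Q - Z) = v * cross2 (Y - X) (Z - X)"
    using cross2_combination[of w u v Q Z X Y] uvw Q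
    by (simp add: cross2_rotate[of X Z Y] cross2_rotate[of Z Y X] add_ac)
  ultimately show "?z \<and> ?x \<and> ?y"
    using assms uvw by (simp add: mult.left_commute[of s])
next
  assume *: "?z \<and> ?x \<and> ?y"
  let ?d = "cross2 (Y - X) (Z - X)"
  have d: "?d \<noteq> 0" using assms by auto
  let ?u = "cross2 (Z - Y) (Q - Y) / ?d" and ?v = "cross2 (X - Z) (Q - Z) / ?d"
    and ?w = "cross2 (Y - X) (Q - X) / ?d"
  have pos: "0 \<le> x / ?d" if "0 \<le> s * x" for x
    using that assms by (auto simp: zero_le_mult_iff zero_less_mult_iff divide_simps)
  have "?u + ?v + ?w = 1"
    using cross2_sum_edges[of Z Y Q X] d by (simp add: add_divide_distrib[symmetric])
  moreover have "Q = ?u *\<^sub>R X + ?v *\<^sub>R Y + ?w *\<^sub>R Z"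
  proof -
    have "Q = (1 / ?d) *\<^sub>R (?d *\<^sub>R Q)" using d by simp
    also have "\<dots> = ?u *\<^sub>R X + ?v *\<^sub>R Y + ?w *\<^sub>R Z"
      unfolding cross2_barycentric[of Y X Z Q] by (simp add: scaleR_add_right)
    finally show ?thesis .
  qed
  ultimately show "Q \<in> convex hull {X, Y, Z}"
    unfolding convex_hull_3 using * pos by blast
qed

section \<open>Incircles, and the inradius as twice the area over the perimeter\<close>

lemma unit_normal_exists:
  assumes "s = 1 \<or> s = -1" "u \<noteq> 0"
  obtains n where "norm n = 1" "s * cross2 u n = norm u"
proof
  let ?J = "vector [- (u $ 2), u $ 1] :: real^2"
  have nJ: "norm ?J = norm u"
    by (simp add: norm_eq_sqrt_inner inner_vec_def sum_2 add.commute)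
  have cJ: "cross2 u ?J = norm u * norm u"
    by (simp add: cross2_def power2_norm_eq_inner[unfolded power2_eq_square] inner_vec_def sum_2)
  show "norm ((s / norm u) *\<^sub>R ?J) = 1"
    using assms nJ by auto
  show "s * cross2 u ((s / norm u) *\<^sub>R ?J) = norm u"
    using assms cJ by auto
qed

text \<open>A contact point puts the distance from \<open>I\<close> to the side at most
  \<open>r\<close>, while containment of the disc puts it at least \<open>r\<close>.\<close>

lemma disc_touches_side_iff:
  assumes s: "s = 1 \<or> s = -1" and pos: "0 < s * cross2 (Y - X) (Z - X)"
    and r: "0 < r" and disc: "cball I r \<subseteq> convex hull {X, Y, Z}"
  shows "sphere I r \<inter> closed_segment X Y \<noteq> {} \<longleftrightarrow> r * norm (Y - X) = s * cross2 (Y - X) (I - X)"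
proof -
  have "Y - X \<noteq> 0" using pos by auto
  then obtain n where n: "norm n = 1" "s * cross2 (Y - X) n = norm (Y - X)"
    using unit_normal_exists[OF s] by blast
  \<comment> \<open>With \<open>n\<close> the inward unit normal, \<open>T\<close> is the point of
    the disc furthest towards the line \<open>XY\<close>, hence the candidate contact point.\<close>
  define T where "T = I - r *\<^sub>R n"
  have T_sphere: "T \<in> sphere I r"
    using n r by (simp add: T_def dist_norm)
  then have T_hull: "T \<in> convex hull {X, Y, Z}"
    using disc by auto
  have T_cross: "s * cross2 (Y - X) (T - X) = s * cross2 (Y - X) (I - X) - r * norm (Y - X)"
    unfolding T_def n(2)[symmetric] by (simp add: cross2_distrib algebra_simps)
  show ?thesis
  proof
    assume "sphere I r \<inter> closed_segment X Y \<noteq> {}"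
    then obtain S where S: "dist I S = r" "S \<in> closed_segment X Y"
      by (metis disjoint_iff mem_sphere)
    then obtain u where "S = (1 - u) *\<^sub>R X + u *\<^sub>R Y"
      by (auto simp: in_segment)
    then have "cross2 (Y - X) (S - X) = 0"
      using cross2_combination[of "1 - u" u 0 S X Y Z] by simp
    then have "cross2 (Y - X) (I - X) = cross2 (Y - X) (I - S)"
      by (simp add: cross2_distrib)
    then have "s * cross2 (Y - X) (I - X) \<le> norm (Y - X) * norm (I - S)"
      using abs_cross2_le[of "Y - X" "I - S"] s by auto
    then have "s * cross2 (Y - X) (I - X) \<le> r * norm (Y - X)"
      using S by (simp add: dist_norm mult.commute)
    moreover have "0 \<le> s * cross2 (Y - X) (T - X)"
      using T_hull in_triangle_iff[OF pos] by blast
    ultimately show "r * norm (Y - X) = s * cross2 (Y - X) (I - X)"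
      using T_cross by simp
  next
    assume "r * norm (Y - X) = s * cross2 (Y - X) (I - X)"
    then have "cross2 (Y - X) (T - X) = 0"
      using T_cross s by auto
    moreover obtain u v w where uvw: "0 \<le> u" "0 \<le> v" "u + v + w = 1"
      and T: "T = u *\<^sub>R X + v *\<^sub>R Y + w *\<^sub>R Z"
      using T_hull unfolding convex_hull_3 by auto
    ultimately have "w = 0"
      using cross2_combination[OF uvw(3) T] pos by auto
    then have "T \<in> closed_segment X Y"
      using uvw T by (auto simp: in_segment intro!: exI[of _ v])
    then show "sphere I r \<inter> closed_segment X Y \<noteq> {}"
      using T_sphere by blast
  qed
qed

text \<open>Once \<open>I\<close> has signed distance \<open>r\<close> from all three sides, a point
  within \<open>r\<close> of \<open>I\<close> cannot cross any of them, so containment of the disc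
  follows from the three equations.\<close>

lemma incircle_iff:
  assumes s: "s = 1 \<or> s = -1" and pos: "0 < s * cross2 (Y - X) (Z - X)"
  shows "incircle X Y Z I r \<longleftrightarrow> 0 < r \<and>
    r * norm (Y - X) = s * cross2 (Y - X) (I - X) \<and>
    r * norm (Z - Y) = s * cross2 (Z - Y) (I - Y) \<and>
    r * norm (X - Z) = s * cross2 (X - Z) (I - Z)" (is "_ \<longleftrightarrow> 0 < r \<and> ?sides")
proof -
  have touch: "(sphere I r \<inter> closed_segment X Y \<noteq> {} \<and> sphere I r \<inter> closed_segment Y Z \<noteq> {} \<and>
      sphere I r \<inter> closed_segment Z X \<noteq> {}) \<longleftrightarrow> ?sides"
    if "0 < r" "cball I r \<subseteq> convex hull {X, Y, Z}"
    using disc_touches_side_iff[OF s, of Y X Z r I] disc_touches_side_iff[OF s, of Z Y X r I]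
      disc_touches_side_iff[OF s, of X Z Y r I] that pos
    by (simp add: cross2_rotate[of X Z Y] cross2_rotate[of Z Y X] insert_commute)
  have disc: "cball I r \<subseteq> convex hull {X, Y, Z}" if "0 < r" and sides: ?sides
  proof
    fix Q assume "Q \<in> cball I r"
    then have near: "norm (I - Q) \<le> r" by (simp add: dist_norm)
    have side: "0 \<le> s * cross2 (V - U) (Q - U)"
      if "r * norm (V - U) = s * cross2 (V - U) (I - U)" for U V
    proof -
      have "s * cross2 (V - U) (I - Q) \<le> norm (V - U) * norm (I - Q)"
        using abs_cross2_le[of "V - U" "I - Q"] s by auto
      also have "\<dots> \<le> r * norm (V - U)"
        using near by (simp add: mult.commute mult_right_mono)
      finally show ?thesis
        unfolding that by (simp add: cross2_distrib algebra_simps)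
    qed
    show "Q \<in> convex hull {X, Y, Z}"
      using in_triangle_iff[OF pos] side sides by blast
  qed
  show ?thesis
    unfolding incircle_def using touch disc by blast
qed

text \<open>Adding the three side equations of \<open>incircle_iff\<close> gives \<open>r\<close>
  times the perimeter as twice the area, which settles uniqueness; existence needs an explicit
  centre.\<close>

lemma inradius_eq:
  assumes s: "s = 1 \<or> s = -1" and pos: "0 < s * cross2 (Y - X) (Z - X)"
  shows "inradius X Y Z =
    s * cross2 (Y - X) (Z - X) / (norm (Y - X) + norm (Z - Y) + norm (X - Z))"
proof -
  let ?d = "cross2 (Y - X) (Z - X)" and ?p = "norm (Y - X) + norm (Z - Y) + norm (X - Z)"
  let ?r = "s * ?d / ?p"
  have "Y - X \<noteq> 0" using pos by auto
  then have p: "0 < ?p" by (smt (verit) norm_ge_zero zero_less_norm_iff)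
  \<comment> \<open>The incentre has barycentric weights proportional to the opposite sides.\<close>
  define I where "I = (norm (Z - Y) / ?p) *\<^sub>R X + (norm (X - Z) / ?p) *\<^sub>R Y + (norm (Y - X) / ?p) *\<^sub>R Z"
  have sum1: "norm (Z - Y) / ?p + norm (X - Z) / ?p + norm (Y - X) / ?p = 1"
    using p by (simp add: add_divide_distrib[symmetric])
  have "incircle X Y Z I ?r"
    unfolding incircle_iff[OF s pos]
    using pos p cross2_combination[OF sum1 I_def]
      cross2_combination[of "norm (X - Z) / ?p" "norm (Y - X) / ?p" "norm (Z - Y) / ?p" I Y Z X]
      cross2_combination[of "norm (Y - X) / ?p" "norm (Z - Y) / ?p" "norm (X - Z) / ?p" I Z X Y]
      sum1
    by (simp add: cross2_rotate[of X Z Y] cross2_rotate[of Z Y X] I_def add_ac)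
  moreover have "r = ?r" if "incircle X Y Z J r" for J r
  proof -
    have "r * ?p = s * (cross2 (Z - Y) (J - Y) + cross2 (X - Z) (J - Z) + cross2 (Y - X) (J - X))"
      using that unfolding incircle_iff[OF s pos] by (simp add: algebra_simps)
    then show ?thesis
      unfolding cross2_sum_edges using p by (simp add: field_simps)
  qed
  ultimately show ?thesis
    unfolding inradius_def by (intro the_equality) blast+
qed

text \<open>Brings the side of known length to the front, as \<open>inradius_ASA\<close>
  requires.\<close>

lemma inradius_rotate: "inradius Y Z X = inradius X Y Z"
  unfolding inradius_def incircle_def by (simp add: insert_commute conj_ac)

section \<open>Directions in degrees and oriented angles\<close>

text \<open>The sign \<open>s = 1\<close> or \<open>s = -1\<close> records the orientation of the figure, so that angles
  can be added with a fixed sense of rotation.\<close>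

definition ray :: "real \<Rightarrow> real \<Rightarrow> real^2" where
  "ray s x = vector [cos (degrees x), s * sin (degrees x)]"

lemma degrees_arith: "degrees (x + y) = degrees x + degrees y" "degrees (x - y) = degrees x - degrees y"
    "degrees (- x) = - degrees x"
  by (simp_all add: degrees_def field_simps)

lemma degrees_special [simp]: "degrees 0 = 0" "degrees 90 = pi / 2" "degrees 180 = pi"
  by (simp_all add: degrees_def)

lemma sin_degrees_supplement: "sin (degrees (180 - x)) = sin (degrees x)"
  by (simp add: degrees_arith)

lemma sin_degrees_complement: "sin (degrees (90 - x)) = cos (degrees x)"
  by (simp add: cos_sin_eq degrees_def field_simps)

lemma sin_degrees_pos: "0 < x \<Longrightarrow> x < 180 \<Longrightarrow> 0 < sin (degrees x)"
  by (intro sin_gt_zero) (simp_all add: degrees_def field_simps)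

lemma sin_degrees_30: "sin (degrees 30) = 1 / 2"
  using sin_30 by (simp add: degrees_def)

lemma ray_uminus: "ray (- s) (- x) = ray s x"
  by (simp add: ray_def degrees_arith)

lemma ray_add_180: "ray s (x + 180) = - ray s x"
  by (simp add: ray_def degrees_arith vec_eq_iff forall_2)

lemma norm_ray [simp]: "s = 1 \<or> s = -1 \<Longrightarrow> norm (ray s x) = 1"
  by (auto simp: norm_eq_sqrt_inner inner_vec_def sum_2 ray_def power2_eq_square[symmetric])

lemma cross2_ray: "cross2 (ray s x) (ray s y) = s * sin (degrees (y - x))"
  by (simp add: cross2_def ray_def degrees_arith sin_diff algebra_simps)

lemma ray_add_ray: "ray s (x + y) + ray s (x - y) = (2 * cos (degrees y)) *\<^sub>R ray s x"
  by (simp add: ray_def vec_eq_iff forall_2 degrees_arith sin_add sin_diff cos_add cos_diff algebra_simps)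

text \<open>Expansion in the orthonormal basis formed by a ray and its quarter turn; the factor
  \<open>s\<close> corrects the area for a reflected figure.\<close>

lemma ray_decompose:
  assumes "s = 1 \<or> s = -1"
  shows "w = (ray s x \<bullet> w) *\<^sub>R ray s x + (s * cross2 (ray s x) w) *\<^sub>R ray s (x + 90)"
proof -
  let ?c = "cos (degrees x)" and ?s = "sin (degrees x)"
  have r90: "ray s (x + 90) = vector [- ?s, s * ?c]"
    using sin_cos_eq[of "- degrees x"] cos_sin_eq[of "- degrees x"]
    by (simp add: ray_def degrees_arith(1)) (simp add: add.commute)
  have one: "?c * ?c + ?s * ?s = 1"
    using sin_cos_squared_add2[of "degrees x"] by (simp add: power2_eq_square)
  have ss: "s * s = 1" using assms by auto
  have "(?c * w $ 1 + s * ?s * w $ 2) * ?c + s * (?c * w $ 2 - s * ?s * w $ 1) * - ?s = w $ 1"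
    using one ss by algebra
  moreover have "(?c * w $ 1 + s * ?s * w $ 2) * (s * ?s) + s * (?c * w $ 2 - s * ?s * w $ 1) * (s * ?c) = w $ 2"
    using one ss by algebra
  ultimately show ?thesis
    by (simp add: r90 vec_eq_iff forall_2 cross2_def inner_vec_def sum_2) (simp add: ray_def)
qed

lemma parallel_ray:
  assumes "s = 1 \<or> s = -1" "cross2 w (ray s x) = 0"
  shows "w = (ray s x \<bullet> w) *\<^sub>R ray s x"
proof -
  have "cross2 (ray s x) w = 0" using assms(2) by (simp add: cross2_def algebra_simps)
  then show ?thesis using ray_decompose[OF assms(1), of w x] by simp
qed

lemma polar_form:
  assumes s: "s = 1 \<or> s = -1"
  obtains x where "v = norm v *\<^sub>R ray s x"
proof (cases "v = 0")
  case True
  then show ?thesis using that by simp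
next
  case False
  have n: "(v $ 1)\<^sup>2 + (s * v $ 2)\<^sup>2 = (norm v)\<^sup>2"
    using s unfolding power2_norm_eq_inner inner_vec_def sum_2 by (auto simp: power2_eq_square)
  have "(v $ 1 / norm v)\<^sup>2 + (s * v $ 2 / norm v)\<^sup>2 = 1"
    using n False by (simp add: power_divide add_divide_distrib[symmetric])
  then obtain x where x: "v $ 1 / norm v = cos x" "s * v $ 2 / norm v = sin x"
    using sincos_total_2pi by metis
  have "degrees (x * 180 / pi) = x" by (simp add: degrees_def)
  then have "v = norm v *\<^sub>R ray s (x * 180 / pi)"
    using False s unfolding vec_eq_iff forall_2 by (auto simp: ray_def x[symmetric])
  then show ?thesis using that by blast
qed

text \<open>The unoriented angle supplies only the cosine. Lagrange's identity then gives the sine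
  up to sign, and the orientation hypothesis fixes the sign.\<close>

lemma angle_counterclockwise:
  assumes s: "s = 1 \<or> s = -1" and X: "X - Y = norm (X - Y) *\<^sub>R ray s x"
    and ang: "angle X Y Z = degrees a" and pos: "0 < s * cross2 (X - Y) (Z - Y)"
  shows "Z - Y = norm (Z - Y) *\<^sub>R ray s (x + a)"
proof -
  let ?u = "X - Y" and ?w = "Z - Y"
  let ?q = "(?u \<bullet> ?w) / (norm ?u * norm ?w)"
  have "?u \<noteq> 0" "?w \<noteq> 0" using pos by auto
  then have nz: "0 < norm ?u" "0 < norm ?w" by simp_all
  have bound: "-1 \<le> ?q" "?q \<le> 1"
    using Cauchy_Schwarz_ineq2[of ?u ?w] nz by (auto simp: divide_simps abs_le_iff)
  have cos_a: "cos (degrees a) = ?q"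
    using ang bound unfolding angle_def by (metis cos_arccos)
  then have inner: "?u \<bullet> ?w = norm ?u * norm ?w * cos (degrees a)"
    using nz by simp
  have "0 \<le> degrees a" "degrees a \<le> pi"
    using ang bound unfolding angle_def by (metis arccos_lbound, metis arccos_ubound)
  then have sin_a: "0 \<le> sin (degrees a)" by (rule sin_ge_zero)
  have "(s * cross2 ?u ?w)\<^sup>2 = (norm ?u * norm ?w)\<^sup>2 * (1 - (cos (degrees a))\<^sup>2)"
    using cross2_sq_plus_inner_sq[of ?u ?w] s unfolding inner
    by (auto simp: power_mult_distrib algebra_simps)
  also have "\<dots> = (norm ?u * norm ?w * sin (degrees a))\<^sup>2"
    by (simp add: power_mult_distrib sin_squared_eq)
  finally have cross: "s * cross2 ?u ?w = norm ?u * norm ?w * sin (degrees a)"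
    using pos nz sin_a by (intro power2_eq_imp_eq[of "s * cross2 ?u ?w"]) auto
  have "norm ?u * (ray s x \<bullet> ?w) = norm ?u * (norm ?w * cos (degrees a))"
    using inner X by (metis inner_scaleR_left mult.assoc)
  then have 1: "ray s x \<bullet> ?w = norm ?w * cos (degrees a)"
    using nz by simp
  have "norm ?u * (s * cross2 (ray s x) ?w) = norm ?u * (norm ?w * sin (degrees a))"
    using cross X by (metis cross2_simps(4) mult.assoc mult.left_commute)
  then have 2: "s * cross2 (ray s x) ?w = norm ?w * sin (degrees a)"
    using nz by simp
  have "ray s (x + a) = cos (degrees a) *\<^sub>R ray s x + sin (degrees a) *\<^sub>R ray s (x + 90)"
    by (simp add: ray_def vec_eq_iff forall_2 degrees_arith sin_add cos_add algebra_simps)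
  then show ?thesis
    using ray_decompose[OF s, of ?w x] by (simp add: 1 2 scaleR_add_right)
qed

text \<open>Reflection: changing the signs of \<open>s\<close> and of all angles turns this into the
  counterclockwise case.\<close>

lemma angle_clockwise:
  assumes "s = 1 \<or> s = -1" "X - Y = norm (X - Y) *\<^sub>R ray s x"
    and "angle X Y Z = degrees a" "0 < s * cross2 (Z - Y) (X - Y)"
  shows "Z - Y = norm (Z - Y) *\<^sub>R ray s (x - a)"
proof -
  have "0 < - s * cross2 (X - Y) (Z - Y)"
    using assms(4) by (simp add: cross2_def algebra_simps)
  then have "Z - Y = norm (Z - Y) *\<^sub>R ray (- s) (- x + a)"
    using assms by (intro angle_counterclockwise) (auto simp: ray_uminus)
  then show ?thesis
    using ray_uminus[of s "x - a"] by (simp add: add.commute)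
qed

section \<open>Triangles given by a side and the directions of the other two sides\<close>

text \<open>The law of sines gives the two other sides, and \<open>inradius_eq\<close> the rest. The
  vertex \<open>Z\<close> enters only as the intersection of two lines, which is how the feet of the
  cevians are known.\<close>

lemma inradius_ASA:
  assumes s: "s = 1 \<or> s = -1" and c: "0 < c" and a: "0 < a" and b: "0 < b" and ab: "a + b < 180"
    and Y: "Y - X = c *\<^sub>R ray s x"
    and ZX: "cross2 (Z - X) (ray s (x + a)) = 0" and ZY: "cross2 (Z - Y) (ray s (x - b)) = 0"
  shows "inradius X Y Z = c * sin (degrees a) * sin (degrees b) /
    (sin (degrees a) + sin (degrees b) + sin (degrees (a + b)))"
proof -
  let ?sa = "sin (degrees a)" and ?sb = "sin (degrees b)" and ?sc = "sin (degrees (a + b))"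
  have pos: "0 < ?sa" "0 < ?sb" "0 < ?sc"
    using a b ab by (intro sin_degrees_pos; simp)+
  obtain k where k: "Z - X = k *\<^sub>R ray s (x + a)"
    using parallel_ray[OF s ZX] by blast
  obtain l where l: "Z - Y = l *\<^sub>R ray s (x - b)"
    using parallel_ray[OF s ZY] by blast
  have eq: "k *\<^sub>R ray s (x + a) - c *\<^sub>R ray s x = l *\<^sub>R ray s (x - b)"
    using Y k l by (simp add: algebra_simps)
  \<comment> \<open>Taking the area against the direction of one unknown side removes that side and
    leaves the other.\<close>
  have "cross2 (k *\<^sub>R ray s (x + a) - c *\<^sub>R ray s x) (ray s (x - b)) = 0"
    unfolding eq by simp
  then have "s * (c * ?sb) = s * (k * ?sc)"
    using sin_minus[of "degrees (a + b)"]
    by (simp add: cross2_distrib cross2_ray degrees_arith algebra_simps)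
  then have k': "k = c * ?sb / ?sc"
    using s pos by (auto simp: field_simps)
  have "cross2 (k *\<^sub>R ray s (x + a) - c *\<^sub>R ray s x) (ray s (x + a)) =
      cross2 (l *\<^sub>R ray s (x - b)) (ray s (x + a))"
    unfolding eq ..
  then have "s * (c * ?sa) = s * (- l * ?sc)"
    by (simp add: cross2_distrib cross2_ray add.commute) (simp add: algebra_simps)
  then have l': "l = - (c * ?sa / ?sc)"
    using s pos by (auto simp: divide_simps)
  have norms: "norm (Y - X) = c" "norm (X - Z) = c * ?sb / ?sc" "norm (Z - Y) = c * ?sa / ?sc"
    unfolding Y l norm_minus_commute[of X Z] k using c s pos by (simp_all add: k' l')
  have area: "s * cross2 (Y - X) (Z - X) = c * (c * ?sb / ?sc) * ?sa"
    unfolding Y k using s by (auto simp: cross2_ray k')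
  have perimeter: "c + c * ?sa / ?sc + c * ?sb / ?sc = c * (?sa + ?sb + ?sc) / ?sc"
    using pos by (simp add: field_simps)
  have "0 < s * cross2 (Y - X) (Z - X)"
    unfolding area using c pos by simp
  from inradius_eq[OF s this] show ?thesis
    unfolding norms area using c pos perimeter by simp
qed

lemma cross2_line:
  assumes "Q \<in> affine hull {X, Y}" "Y - X = k *\<^sub>R ray s x"
  shows "cross2 (Q - X) (ray s x) = 0" "cross2 (Q - Y) (ray s x) = 0"
proof -
  obtain u v where uv: "u + v = 1" "Q = u *\<^sub>R X + v *\<^sub>R Y"
    using assms(1) by (auto simp: affine_hull_2)
  have u: "u = 1 - v" using uv(1) by simp
  have "Q - X = (v * k) *\<^sub>R ray s x"
    unfolding uv(2) u scaleR_scaleR[symmetric] assms(2)[symmetric] by (simp add: algebra_simps)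
  moreover have "Q - Y = ((v - 1) * k) *\<^sub>R ray s x"
    unfolding uv(2) u scaleR_scaleR[symmetric] assms(2)[symmetric] by (simp add: algebra_simps)
  ultimately show "cross2 (Q - X) (ray s x) = 0" "cross2 (Q - Y) (ray s x) = 0"
    by simp_all
qed

section \<open>Sines of multiples of ten degrees as polynomials in \<open>t\<close>\<close>

text \<open>The Chebyshev recursion.\<close>

lemma cos_degrees_step:
  "cos (degrees (x + 10)) = 2 * cos (degrees 10) * cos (degrees x) - cos (degrees (x - 10))"
  by (simp add: degrees_arith cos_add cos_diff)

lemma sines_multiples_of_10:
  defines "t \<equiv> 2 * cos (degrees 10)"
  shows "sin (degrees 80) = t / 2"
    "sin (degrees 70) = (t^2 - 2) / 2"
    "sin (degrees 60) = (t^3 - 3 * t) / 2"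
    "sin (degrees 50) = (t^4 - 4 * t^2 + 2) / 2"
    "sin (degrees 40) = (t^5 - 5 * t^3 + 5 * t) / 2"
    "sin (degrees 20) = (5 * t^3 - 4 * t - t^5) / 2"
    "sin (degrees 10) = (5 * t^2 - 4 - t^4) / 2"
    "t^6 - 6 * t^4 + 9 * t^2 = 3"
proof -
  have c: "cos (degrees 10) = t / 2" by (simp add: t_def)
  have c20: "cos (degrees 20) = (t^2 - 2) / 2"
    using cos_degrees_step[of 10] by (simp add: c power2_eq_square field_simps)
  have c30: "cos (degrees 30) = (t^3 - 3 * t) / 2"
    using cos_degrees_step[of 20] by (simp add: c c20 field_simps eval_nat_numeral)
  have c40: "cos (degrees 40) = (t^4 - 4 * t^2 + 2) / 2"
    using cos_degrees_step[of 30] by (simp add: c30 c20 c field_simps eval_nat_numeral)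
  have c50: "cos (degrees 50) = (t^5 - 5 * t^3 + 5 * t) / 2"
    using cos_degrees_step[of 40] by (simp add: c30 c40 c field_simps eval_nat_numeral)
  \<comment> \<open>Comparing this known value with the result of the recursion gives the minimal
    polynomial of \<open>t\<close>. Continuing the recursion from \<open>1 / 2\<close> also keeps
    the later degrees low.\<close>
  have c60: "cos (degrees 60) = 1 / 2"
    using sin_degrees_complement[of 60] sin_degrees_30 by simp
  have "cos (degrees 60) = (t^6 - 6 * t^4 + 9 * t^2 - 2) / 2"
    using cos_degrees_step[of 50] by (simp add: c50 c40 c field_simps eval_nat_numeral)
  then show m: "t^6 - 6 * t^4 + 9 * t^2 = 3"
    using c60 by simp
  have c70: "cos (degrees 70) = (5 * t^3 - 4 * t - t^5) / 2"
    using cos_degrees_step[of 60] by (simp add: c50 c60 c field_simps)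
  have "cos (degrees 80) = (5 * t^4 - 4 * t^2 - t^6 - 1) / 2"
    using cos_degrees_step[of 70] by (simp add: c60 c70 c field_simps eval_nat_numeral)
  then have c80: "cos (degrees 80) = (5 * t^2 - 4 - t^4) / 2"
    using m by simp
  show "sin (degrees 80) = t / 2" "sin (degrees 70) = (t^2 - 2) / 2"
    "sin (degrees 60) = (t^3 - 3 * t) / 2" "sin (degrees 50) = (t^4 - 4 * t^2 + 2) / 2"
    "sin (degrees 40) = (t^5 - 5 * t^3 + 5 * t) / 2" "sin (degrees 20) = (5 * t^3 - 4 * t - t^5) / 2"
    "sin (degrees 10) = (5 * t^2 - 4 - t^4) / 2"
    using sin_degrees_complement[of 10] sin_degrees_complement[of 20] sin_degrees_complement[of 30]
      sin_degrees_complement[of 40] sin_degrees_complement[of 50] sin_degrees_complement[of 70]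
      sin_degrees_complement[of 80] c c20 c30 c40 c50 c70 c80
    by simp_all
qed

abbreviation dsin :: "real \<Rightarrow> real" where "dsin x \<equiv> sin (degrees x)"

text \<open>Every quotient below is an element of the degree 6 field generated by \<open>t = 2 cos 10\<degree>\<close>.  The
  polynomials in \<open>t\<close> are the quotients in the power basis, and the cofactors of the minimal
  polynomial certify the reductions.\<close>

lemma sine_identity:
  fixes g :: real
  defines "f \<equiv> \<lambda>c a b. c * dsin a * dsin b / (dsin a + dsin b + dsin (a + b))"
  shows "5 * f (2 * dsin 80 * g) 30 30 + 6 * f g 80 40 + f g 20 30 =
    f g 110 20 + 3 * f g 40 20 + 15 * f (2 * dsin 80 * g) 10 110"
proof -
  define t where "t = 2 * cos (degrees 10)"
  note sines = sines_multiples_of_10[folded t_def]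
  have s110: "dsin 110 = dsin 70" and s120: "dsin 120 = dsin 60" and s130: "dsin 130 = dsin 50"
    using sin_degrees_supplement[of 70] sin_degrees_supplement[of 60] sin_degrees_supplement[of 50]
    by simp_all
  note m = sines(8)
  have pos: "0 < dsin 10" "0 < dsin 20" "0 < dsin 30" "0 < dsin 40" "0 < dsin 50" "0 < dsin 60"
      "0 < dsin 70" "0 < dsin 80"
    by (intro sin_degrees_pos; simp)+
  have f: "f (c * g) a b = p * g"
    if "c * dsin a * dsin b = p * (dsin a + dsin b + C) + q * (t^6 - 6 * t^4 + 9 * t^2 - 3)"
      "dsin (a + b) = C" "0 < dsin a" "0 < dsin b" "0 < C" for a b c p q C
  proof -
    have "dsin a + dsin b + C \<noteq> 0" using that by linarith
    then have "c * dsin a * dsin b / (dsin a + dsin b + C) = p"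
      using that(1) m by (simp add: nonzero_divide_eq_eq)
    moreover have "f (c * g) a b = c * dsin a * dsin b / (dsin a + dsin b + C) * g"
      by (simp add: f_def that(2))
    ultimately show ?thesis by simp
  qed
  note poly = sines(1-7) sin_degrees_30 s110
  have "2 * dsin 80 * dsin 30 * dsin 30 = (t + 3/2 * t^2 - 1/2 * t^4) * (dsin 30 + dsin 30 + dsin 60)
      + (1/4 * t) * (t^6 - 6 * t^4 + 9 * t^2 - 3)"
    unfolding poly by (simp add: field_simps eval_nat_numeral)
  from f[OF this] have f1: "f (2 * dsin 80 * g) 30 30 = (t + 3/2 * t^2 - 1/2 * t^4) * g"
    using pos by (simp add: s110 s120 s130)
  \<comment> \<open>The factor 1 is kept so that \<open>f\<close> applies with
    \<open>c = 1\<close>.\<close>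
  have "1 * dsin 80 * dsin 40 = (3/2 * t - t^3 + 1/6 * t^5) * (dsin 80 + dsin 40 + dsin 60)
      + (1/3 * t^2 - 1/12 * t^4) * (t^6 - 6 * t^4 + 9 * t^2 - 3)"
    unfolding poly by (simp add: field_simps eval_nat_numeral)
  from f[OF this] have f2: "f (1 * g) 80 40 = (3/2 * t - t^3 + 1/6 * t^5) * g"
    using pos by (simp add: s110 s120 s130)
  have "1 * dsin 110 * dsin 20 = (- 17/2 + 21/2 * t + 8 * t^2 - 17/2 * t^3 - 3/2 * t^4 + 3/2 * t^5) * (dsin 110 + dsin 20 + dsin 50)
      + (5 * t - 11/4 * t^2 - 3/2 * t^3 + 3/4 * t^4) * (t^6 - 6 * t^4 + 9 * t^2 - 3)"
    unfolding poly by (simp add: field_simps eval_nat_numeral)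
  from f[OF this] have f3: "f (1 * g) 110 20 = (- 17/2 + 21/2 * t + 8 * t^2 - 17/2 * t^3 - 3/2 * t^4 + 3/2 * t^5) * g"
    using pos by (simp add: s110 s120 s130)
  have "1 * dsin 20 * dsin 30 = (- 17/2 - 25/2 * t + 8 * t^2 + 11 * t^3 - 3/2 * t^4 - 2 * t^5) * (dsin 20 + dsin 30 + dsin 50)
      + (- 17/4 - 1/4 * t + 21/4 * t^2 + 1/4 * t^3 - t^4) * (t^6 - 6 * t^4 + 9 * t^2 - 3)"
    unfolding poly by (simp add: field_simps eval_nat_numeral)
  from f[OF this] have f4: "f (1 * g) 20 30 = (- 17/2 - 25/2 * t + 8 * t^2 + 11 * t^3 - 3/2 * t^4 - 2 * t^5) * g"
    using pos by (simp add: s110 s120 s130)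
  have "1 * dsin 40 * dsin 20 = (2 * t - 1/2 * t^3) * (dsin 40 + dsin 20 + dsin 60)
      + (t^2 - 1/4 * t^4) * (t^6 - 6 * t^4 + 9 * t^2 - 3)"
    unfolding poly by (simp add: field_simps eval_nat_numeral)
  from f[OF this] have f5: "f (1 * g) 40 20 = (2 * t - 1/2 * t^3) * g"
    using pos by (simp add: s110 s120 s130)
  have "2 * dsin 80 * dsin 10 * dsin 110 = (- t + 1/2 * t^2 + t^3 - 1/6 * t^4 - 1/6 * t^5) * (dsin 10 + dsin 110 + dsin 60)
      + (1/3 * t - 1/12 * t^3) * (t^6 - 6 * t^4 + 9 * t^2 - 3)"
    unfolding poly by (simp add: field_simps eval_nat_numeral)
  from f[OF this] have f6: "f (2 * dsin 80 * g) 10 110 = (- t + 1/2 * t^2 + t^3 - 1/6 * t^4 - 1/6 * t^5) * g"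
    using pos by (simp add: s110 s120 s130)
  \<comment> \<open>In the power basis the two sides agree coefficient by coefficient.\<close>
  show ?thesis
    using f1 f2 f3 f4 f5 f6 by (simp add: algebra_simps)
qed

section \<open>Solving the figure and combining the six inradii\<close>

theorem theorem7p1:
  fixes A B C P D E F :: "real^2"
    and r1 r2 r3 r4 r5 r6 :: real
  assumes "\<not> collinear {A, B, C}"
    and "P \<in> interior (convex hull {A, B, C})"
    and "angle A B P = degrees 10"
    and "angle P B C = degrees 30"
    and "angle B C P = degrees 80"
    and "angle P C A = degrees 20"
    and "D \<in> affine hull {A, P} \<inter> closed_segment B C"
    and "E \<in> affine hull {B, P} \<inter> closed_segment C A"
    and "F \<in> affine hull {C, P} \<inter> closed_segment A B"
    and "r1 = inradius P B D"
    and "r2 = inradius P D C"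
    and "r3 = inradius P C E"
    and "r4 = inradius P E A"
    and "r5 = inradius P A F"
    and "r6 = inradius P F B"
  shows "5 * r1 + 6 * r2 + r4 = r3 + 3 * r5 + 15 * r6"
proof -
  let ?d = "cross2 (B - A) (C - A)"
  define s where "s = sgn ?d"
  have d: "?d \<noteq> 0"
    using assms(1) cross2_eq_0_imp_collinear by blast
  then have s: "s = 1 \<or> s = -1" and sd: "0 < s * ?d"
    by (auto simp: s_def sgn_if)
  obtain u v w where uvw: "0 < u" "0 < v" "0 < w" "u + v + w = 1"
    and P: "P = u *\<^sub>R A + v *\<^sub>R B + w *\<^sub>R C"
    using assms(2) interior_convex_hull_3_minimal[OF assms(1)] by auto
  have crossP: "cross2 (B - A) (P - A) = w * ?d" "cross2 (C - B) (P - B) = u * ?d"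
      "cross2 (A - C) (P - C) = v * ?d"
    using cross2_combination[OF uvw(4) P] cross2_combination[of v w u P B C A]
      cross2_combination[of w u v P C A B] uvw(4) P
    by (simp_all add: cross2_rotate[of C B A] cross2_rotate[of A C B] add_ac)
  \<comment> \<open>The weights of the interior point \<open>P\<close> are positive, so all small
    areas share the sign of the whole one. This fixes the sense of rotation of each given
    angle.\<close>
  have orient: "0 < s * cross2 (P - B) (A - B)" "0 < s * cross2 (C - B) (P - B)"
      "0 < s * cross2 (P - C) (B - C)" "0 < s * cross2 (A - C) (P - C)"
  proof -
    have "cross2 (P - B) (A - B) = w * ?d" "cross2 (P - C) (B - C) = u * ?d"
      unfolding crossP[symmetric] by (simp_all add: cross2_def algebra_simps)
    then show "0 < s * cross2 (P - B) (A - B)" "0 < s * cross2 (C - B) (P - B)"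
      "0 < s * cross2 (P - C) (B - C)" "0 < s * cross2 (A - C) (P - C)"
      using crossP sd uvw by (simp_all add: mult.left_commute[of s])
  qed
  obtain x where PB: "P - B = norm (P - B) *\<^sub>R ray s x"
    using polar_form[OF s] .
  have AB: "A - B = norm (A - B) *\<^sub>R ray s (x + 10)"
  proof (rule angle_counterclockwise[OF s PB])
    show "angle P B A = degrees 10"
      using assms(3) by (simp add: angle_def inner_commute mult.commute)
  qed (rule orient)
  have CB: "C - B = norm (C - B) *\<^sub>R ray s (x - 30)"
    using angle_clockwise[OF s PB assms(4)] orient by blast
  \<comment> \<open>Half a turn from \<open>x - 30\<close>, so that the angles at \<open>C\<close>
    can be subtracted from the direction of \<open>CB\<close>.\<close>
  have BC: "B - C = norm (B - C) *\<^sub>R ray s (x + 150)"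
  proof -
    have "ray s (x + 150) = - ray s (x - 30)"
      using ray_add_180[of s "x - 30"] by (simp add: add.commute)
    moreover have "B - C = - (norm (C - B) *\<^sub>R ray s (x - 30))"
      by (subst CB[symmetric]) simp
    ultimately show ?thesis by (simp add: norm_minus_commute)
  qed
  have PC: "P - C = norm (P - C) *\<^sub>R ray s (x + 70)"
    using angle_clockwise[OF s BC assms(5)] orient by (simp add: add_diff_eq[symmetric])
  have AC: "A - C = norm (A - C) *\<^sub>R ray s (x + 50)"
    using angle_clockwise[OF s PC assms(6)] orient by (simp add: add_diff_eq[symmetric])
  define b where "b = norm (P - B)"
  define g where "g = norm (P - C)"
  have "P - B \<noteq> 0" "P - C \<noteq> 0" using orient by auto
  then have pos: "0 < b" "0 < g" by (simp_all add: b_def g_def)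
  note PB = PB[folded b_def] and PC = PC[folded g_def]

  \<comment> \<open>The law of sines in \<open>PBC\<close>: the area against the direction of
    \<open>CB\<close> eliminates the length of \<open>BC\<close>.\<close>
  have "(P - B) - (P - C) = - (norm (B - C) *\<^sub>R ray s (x + 150))"
    unfolding BC[symmetric] by simp
  then have "cross2 ((P - B) - (P - C)) (ray s (x + 150)) = 0"
    by simp
  then have "b * (s * dsin 150) = g * (s * dsin 80)"
    unfolding PB PC by (simp add: cross2_distrib cross2_ray)
  then have "b * dsin 150 = g * dsin 80"
    using s by auto
  moreover have "dsin 150 = 1 / 2"
    using sin_degrees_supplement[of 30] sin_degrees_30 by simp
  ultimately have b: "b = 2 * dsin 80 * g"
    by simp
  have AP: "A - P = g *\<^sub>R ray s (x + 30)"
  proof -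
    define k where "k = norm (A - C)"
    note AC = AC[folded k_def]
    \<comment> \<open>The path from \<open>B\<close> through \<open>P\<close> and \<open>C\<close>
      to \<open>A\<close>; its area against the direction of \<open>BA\<close> vanishes, which
      determines \<open>k\<close> without the length of \<open>AB\<close>.\<close>
    have eq: "A - B = k *\<^sub>R ray s (x + 50) - g *\<^sub>R ray s (x + 70) + b *\<^sub>R ray s x"
      unfolding PB[symmetric] PC[symmetric] AC[symmetric] by simp
    have "cross2 (k *\<^sub>R ray s (x + 50) - g *\<^sub>R ray s (x + 70) + b *\<^sub>R ray s x) (ray s (x + 10)) = 0"
      unfolding eq[symmetric] by (subst AB) simp
    then have "s * (k * dsin 40) = s * (g * dsin 60 + b * dsin 10)"
      by (simp add: cross2_distrib cross2_ray degrees_arith(3)[of 40, simplified]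
          degrees_arith(3)[of 60, simplified] algebra_simps)
    then have "k * dsin 40 = g * (dsin 60 + 2 * dsin 80 * dsin 10)"
      using s by (auto simp: b algebra_simps)
    also have "2 * dsin 80 * dsin 10 = dsin 20"
      using sin_degrees_complement[of 10] degrees_arith(1)[of 10 10] by (simp add: sin_double)
    also have "dsin 60 + dsin 20 = 2 * cos (degrees 20) * dsin 40"
      using sin_add[of "degrees 40" "degrees 20"] sin_diff[of "degrees 40" "degrees 20"]
      unfolding degrees_arith(1,2)[symmetric] by (simp add: mult.commute)
    finally have "k * dsin 40 = (g * (2 * cos (degrees 20))) * dsin 40"
      by simp
    then have k: "k = g * (2 * cos (degrees 20))"
      using sin_degrees_pos[of 40] by simp
    have "A - P = k *\<^sub>R ray s (x + 50) - g *\<^sub>R ray s (x + 70)"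
      unfolding PC[symmetric] AC[symmetric] by simp
    also have "\<dots> = g *\<^sub>R ((2 * cos (degrees 20)) *\<^sub>R ray s (x + 50) - ray s (x + 70))"
      by (simp add: k scaleR_diff_right)
    \<comment> \<open>The direction of \<open>CA\<close> bisects the directions
      \<open>x + 70\<close> and \<open>x + 30\<close>. Subtracting the \<open>CP\<close> part leaves
      a vector of length \<open>g\<close>, so \<open>PA = PC\<close>.\<close>
    also have "(2 * cos (degrees 20)) *\<^sub>R ray s (x + 50) = ray s (x + 70) + ray s (x + 30)"
      using ray_add_ray[of s "x + 50" 20] by (simp add: add.commute)
    finally show ?thesis by simp
  qed
  \<comment> \<open>A line has a direction only modulo half a turn, whereas
    \<open>inradius_ASA\<close> expects the exact values \<open>x + a\<close> and
    \<open>x - b\<close>.\<close>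
  have neg: "cross2 w (ray s (y + 180)) = - cross2 w (ray s y)" for w y
    by (simp add: ray_add_180)
  have BP: "B - P = b *\<^sub>R ray s (x + 180)" and CP: "C - P = g *\<^sub>R ray s (x + 250)"
    and PA: "P - A = g *\<^sub>R ray s (x + 210)"
    using PB PC AP ray_add_180[of s x] ray_add_180[of s "x + 70"] ray_add_180[of s "x + 30"]
    by (simp_all add: algebra_simps)
  have seg: "closed_segment X Y \<subseteq> affine hull {X, Y}" for X Y :: "real^2"
    by (simp add: closed_segment_subset_convex_hull convex_hull_subset_affine_hull segment_convex_hull)
  \<comment> \<open>Each foot is recorded through the directions of the cevian and the side meeting
    there; its position on the side is never computed.\<close>
  have D: "cross2 (D - P) (ray s (x + 30)) = 0" "cross2 (D - B) (ray s (x - 30)) = 0"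
      "cross2 (D - C) (ray s (x - 30)) = 0"
    using assms(7) seg[of B C] cross2_line[OF _ CB, of D] cross2_line[OF _ AP, of D]
    by (auto simp: insert_commute[of A P])
  have E: "cross2 (E - P) (ray s x) = 0" "cross2 (E - C) (ray s (x + 50)) = 0"
      "cross2 (E - A) (ray s (x + 50)) = 0"
    using assms(8) seg[of C A] cross2_line[OF _ PB, of E] cross2_line[OF _ AC, of E]
    by auto
  have F: "cross2 (F - P) (ray s (x + 70)) = 0" "cross2 (F - A) (ray s (x + 10)) = 0"
      "cross2 (F - B) (ray s (x + 10)) = 0"
    using assms(9) seg[of A B] cross2_line[OF _ PC, of F] cross2_line[OF _ AB, of F]
    by (auto simp: insert_commute[of A B])

  note ASA = inradius_ASA[OF s]
  \<comment> \<open>The angles come from differences of directions: from \<open>x + 180\<close>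
    along \<open>PB\<close>, adding 30 gives the line \<open>PD\<close>, and subtracting 30 gives
    the line \<open>BD\<close>, up to half turns.\<close>
  have r1: "r1 = b * dsin 30 * dsin 30 / (dsin 30 + dsin 30 + dsin (30 + 30))"
    unfolding assms(10)
    by (rule ASA[OF pos(1) _ _ _ BP])
       (use D neg[of _ "x + 30"] neg[of _ "x - 30"] in \<open>simp_all add: algebra_simps\<close>)
  have r2: "r2 = g * dsin 80 * dsin 40 / (dsin 80 + dsin 40 + dsin (80 + 40))"
    unfolding assms(11) inradius_rotate[of P D C]
    by (rule ASA[OF pos(2) _ _ _ PC])
       (use D neg[of _ "x - 30"] in \<open>simp_all add: algebra_simps\<close>)
  \<comment> \<open>Here \<open>250 + 110 = 360\<close>, so two half turns lead back to the
    direction \<open>x\<close> of \<open>BE\<close>.\<close>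
  have r3: "r3 = g * dsin 110 * dsin 20 / (dsin 110 + dsin 20 + dsin (110 + 20))"
    unfolding assms(12)
    by (rule ASA[OF pos(2) _ _ _ CP])
       (use E neg[of _ "x + 180"] neg[of _ x] neg[of _ "x + 50"] in \<open>simp_all add: algebra_simps\<close>)
  have r4: "r4 = g * dsin 20 * dsin 30 / (dsin 20 + dsin 30 + dsin (20 + 30))"
    unfolding assms(13) inradius_rotate[of P E A]
    by (rule ASA[OF pos(2) _ _ _ PA])
       (use E neg[of _ x] neg[of _ "x + 50"] in \<open>simp_all add: algebra_simps\<close>)
  have r5: "r5 = g * dsin 40 * dsin 20 / (dsin 40 + dsin 20 + dsin (40 + 20))"
    unfolding assms(14)
    by (rule ASA[OF pos(2) _ _ _ AP]) (use F in \<open>simp_all add: algebra_simps\<close>)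
  have r6: "r6 = b * dsin 10 * dsin 110 / (dsin 10 + dsin 110 + dsin (10 + 110))"
    unfolding assms(15) inradius_rotate[of P F B]
    by (rule ASA[OF pos(1) _ _ _ PB])
       (use F neg[of _ "x - 110"] in \<open>simp_all add: algebra_simps\<close>)
  show ?thesis
    unfolding r1 r2 r3 r4 r5 r6 b by (rule sine_identity)
qed

end
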